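(* Let $S$ be a restriction semigroup and let $R$ be a restriction monoid containing $S$ as a restriction (biunary) subsemigroup, such that for each $r\in R$: (i) there exists $e\in P_S$ with $e\le r^+$, and (ii) $er\in S$ for every $e\in P_S$ with $e\le r^+$; and dually there exists $f\in P_S$ with $f\le r^*$, and $rf\in S$ for every $f\in P_S$ with $f\le r^*$. Let $T$ be a plain monoid, let $\alpha:T\to R$ be a monoidal subhomomorphism, and let $$S_{T,R}=\{(a,t)\in S\times T: a\le t\alpha\text{ in }R\},$$ written $S_T$ in the case $R=S^1$. Then: (1) $S_{T,R}$ is a proper restriction semigroup. (2) If $S\le R\le C(S)$ (that is, $R$ is a restriction submonoid of $C(S)$ containing $S$, where $S$ is identified with its image in $C(S)$), then $S_{T,R}$ is almost perfect if and only if $\alpha$ is a homomorphism. In particular, this is true for $S_T$. (3) If $S$ is a monoid and $\alpha:T\to S$ is monoidal, then $S_T$ is an $F$-restriction monoid; thus $S_T$ is $T$-proper (that is, perfect) if and only if $\alpha$ is also a homomorphism.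
   Context: A restriction semigroup is an algebra $(S,\cdot,{}^+,{}^* )$ with $(S,\cdot)$ a semigroup, satisfying $x^+x=x$, $(x^+y)^+=x^+y^+$, $x^+y^+=y^+x^+$, $xy^+=(xy)^+x$, the dual identities $xx^*=x$, $(yx^* )^*=y^*x^*$, $y^*x^*=x^*y^*$, $y^*x=x(yx)^*$, and $(x^+)^*=x^+$, $(x^* )^+=x^*$. Its projections form the semilattice $P_S=\{x^+:x\in S\}=\{x^*:x\in S\}$. A restriction monoid is a restriction semigroup with identity $1$ (so $1^+=1^*=1$). $S^1$ is $S$ if $S$ has an identity, and otherwise $S$ with an identity $1$ adjoined, $1^+=1^*=1$. A plain monoid is a monoid with no unary operations; when forming $S\times T$ it is regarded as a restriction monoid with $t^+=t^*=1$. The natural partial order is $a\le b$ iff $a=eb$ for some projection $e$; order ideals are nonempty downward-closed subsets. A monoidal subhomomorphism from a plain monoid $T$ to a restriction monoid $R$ is a map $\alpha$ with $1\alpha=1$ and $(t\alpha)(u\alpha)\le(tu)\alpha$ for all $t,u\in T$; it is a homomorphism if equality always holds. Relations on $S$: $a\mathrel{\mathbb R}b$ iff $a^+=b^+$; $a\mathrel{\mathbb L}b$ iff $a^*=b^*$; $\sigma=\{(a,b): ea=eb\text{ for some }e\in P_S\}$ is the least congruence identifying all projections. $S$ is proper if $\mathbb R\cap\sigma$ and $\mathbb L\cap\sigma$ are both the identity relation. $\sigma$ is perfect if $(a\sigma)(b\sigma)=(ab)\sigma$ for all $a,b$ (product of subsets). $S$ is almost perfect if it is proper and $\sigma$ is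 perfect. A restriction monoid is $F$-restriction if it is proper and every $\sigma$-class has a greatest element, and perfect if moreover $\sigma$ is perfect. A restriction monoid $M$ is $T$-proper, for a monoid $T$, if it has a plain submonoid $T'\cong T$ with $M=P_MT'$ such that $\sigma$ separates $T'$. A permissible subset of $S$ is an order ideal $A$ with $a^+b=b^+a$ and $ab^*=ba^*$ for all $a,b\in A$; the set $C(S)$ of permissible subsets is a restriction monoid under multiplication of subsets, with $A^+=\{a^+:a\in A\}$, $A^*=\{a^*:a\in A\}$, identity $P_S$, and natural partial order equal to inclusion. $S$ embeds in $C(S)$ via $a\mapsto\{b:b\le a\}$ and is identified with its image; $S^1$ is likewise identified with a submonoid of $C(S)$, with $1$ corresponding to $P_S$. *)

theory Defs
  imports "HOL-Algebra.Group"
begin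

text \<open>
  Biunary semigroups are records with a carrier, without a field for an identity, because a
  restriction semigroup need not have one. Plain monoids are the monoids of HOL-Algebra.
\<close>

record 'a biunary = "'a partial_object" +
  bmult :: "['a, 'a] \<Rightarrow> 'a" (infixl "\<cdot>\<index>" 70)
  bplus :: "'a \<Rightarrow> 'a" ("_\<^sup>\<oplus>\<index>" [1000] 999)
  bstar :: "'a \<Rightarrow> 'a" ("_\<^sup>\<star>\<index>" [1000] 999)

locale restriction_semigroup =
  fixes S :: "'a biunary" (structure)
  assumes nonempty: "carrier S \<noteq> {}"
    and mult_closed: "\<lbrakk>x \<in> carrier S; y \<in> carrier S\<rbrakk> \<Longrightarrow> x \<cdot> y \<in> carrier S"
    and plus_closed: "x \<in> carrier S \<Longrightarrow> x\<^sup>\<oplus> \<in> carrier S"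
    and star_closed: "x \<in> carrier S \<Longrightarrow> x\<^sup>\<star> \<in> carrier S"
    and assoc: "\<lbrakk>x \<in> carrier S; y \<in> carrier S; z \<in> carrier S\<rbrakk>
      \<Longrightarrow> (x \<cdot> y) \<cdot> z = x \<cdot> (y \<cdot> z)"
    and plus_left: "x \<in> carrier S \<Longrightarrow> x\<^sup>\<oplus> \<cdot> x = x"
    and plus_plus: "\<lbrakk>x \<in> carrier S; y \<in> carrier S\<rbrakk> \<Longrightarrow> (x\<^sup>\<oplus> \<cdot> y)\<^sup>\<oplus> = x\<^sup>\<oplus> \<cdot> y\<^sup>\<oplus>"
    and plus_comm: "\<lbrakk>x \<in> carrier S; y \<in> carrier S\<rbrakk> \<Longrightarrow> x\<^sup>\<oplus> \<cdot> y\<^sup>\<oplus> = y\<^sup>\<oplus> \<cdot> x\<^sup>\<oplus>"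
    and plus_ample: "\<lbrakk>x \<in> carrier S; y \<in> carrier S\<rbrakk> \<Longrightarrow> x \<cdot> y\<^sup>\<oplus> = (x \<cdot> y)\<^sup>\<oplus> \<cdot> x"
    and star_right: "x \<in> carrier S \<Longrightarrow> x \<cdot> x\<^sup>\<star> = x"
    and star_star: "\<lbrakk>x \<in> carrier S; y \<in> carrier S\<rbrakk> \<Longrightarrow> (y \<cdot> x\<^sup>\<star>)\<^sup>\<star> = y\<^sup>\<star> \<cdot> x\<^sup>\<star>"
    and star_comm: "\<lbrakk>x \<in> carrier S; y \<in> carrier S\<rbrakk> \<Longrightarrow> y\<^sup>\<star> \<cdot> x\<^sup>\<star> = x\<^sup>\<star> \<cdot> y\<^sup>\<star>"
    and star_ample: "\<lbrakk>x \<in> carrier S; y \<in> carrier S\<rbrakk> \<Longrightarrow> y\<^sup>\<star> \<cdot> x = x \<cdot> (y \<cdot> x)\<^sup>\<star>"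
    and star_of_plus: "x \<in> carrier S \<Longrightarrow> (x\<^sup>\<oplus>)\<^sup>\<star> = x\<^sup>\<oplus>"
    and plus_of_star: "x \<in> carrier S \<Longrightarrow> (x\<^sup>\<star>)\<^sup>\<oplus> = x\<^sup>\<star>"

definition is_identity :: "'a biunary \<Rightarrow> 'a \<Rightarrow> bool" where
  "is_identity S u \<longleftrightarrow>
     u \<in> carrier S \<and> (\<forall>x\<in>carrier S. u \<cdot>\<^bsub>S\<^esub> x = x \<and> x \<cdot>\<^bsub>S\<^esub> u = x)"

text \<open>The equations \<open>1\<^sup>+ = 1\<^sup>* = 1\<close> follow from \<open>x\<^sup>+ x = x = x x\<^sup>*\<close>.\<close>

definition restriction_monoid :: "'a biunary \<Rightarrow> bool" where
  "restriction_monoid S \<longleftrightarrow> restriction_semigroup S \<and> (\<exists>u. is_identity S u)"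

definition identity :: "'a biunary \<Rightarrow> 'a" where
  "identity S = (THE u. is_identity S u)"

text \<open>The underlying plain monoid of a restriction monoid.\<close>

definition plain_reduct :: "'a biunary \<Rightarrow> 'a monoid" where
  "plain_reduct S = \<lparr>carrier = carrier S, mult = bmult S, one = identity S\<rparr>"

definition projections :: "'a biunary \<Rightarrow> 'a set" where
  "projections S = bplus S ` carrier S"

definition nat_le :: "['a biunary, 'a, 'a] \<Rightarrow> bool" ("(_/ \<preceq>\<index> _)" [51, 51] 50) where
  "a \<preceq>\<^bsub>S\<^esub> b \<longleftrightarrow> (\<exists>e\<in>projections S. a = e \<cdot>\<^bsub>S\<^esub> b)"

definition order_ideal :: "'a biunary \<Rightarrow> 'a set \<Rightarrow> bool" where
  "order_ideal S A \<longleftrightarrow>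
     A \<noteq> {} \<and> A \<subseteq> carrier S \<and> (\<forall>a\<in>A. \<forall>b\<in>carrier S. b \<preceq>\<^bsub>S\<^esub> a \<longrightarrow> b \<in> A)"

definition rel_R :: "'a biunary \<Rightarrow> ('a \<times> 'a) set" where
  "rel_R S = {(a, b). a \<in> carrier S \<and> b \<in> carrier S \<and> a\<^sup>\<oplus>\<^bsub>S\<^esub> = b\<^sup>\<oplus>\<^bsub>S\<^esub>}"

definition rel_L :: "'a biunary \<Rightarrow> ('a \<times> 'a) set" where
  "rel_L S = {(a, b). a \<in> carrier S \<and> b \<in> carrier S \<and> a\<^sup>\<star>\<^bsub>S\<^esub> = b\<^sup>\<star>\<^bsub>S\<^esub>}"

definition rel_sigma :: "'a biunary \<Rightarrow> ('a \<times> 'a) set" where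
  "rel_sigma S = {(a, b). a \<in> carrier S \<and> b \<in> carrier S \<and>
     (\<exists>e\<in>projections S. e \<cdot>\<^bsub>S\<^esub> a = e \<cdot>\<^bsub>S\<^esub> b)}"

definition set_product :: "'a biunary \<Rightarrow> 'a set \<Rightarrow> 'a set \<Rightarrow> 'a set" where
  "set_product S A B = {a \<cdot>\<^bsub>S\<^esub> b | a b. a \<in> A \<and> b \<in> B}"

definition proper :: "'a biunary \<Rightarrow> bool" where
  "proper S \<longleftrightarrow> restriction_semigroup S \<and>
     rel_R S \<inter> rel_sigma S = Id_on (carrier S) \<and>
     rel_L S \<inter> rel_sigma S = Id_on (carrier S)"

definition sigma_perfect :: "'a biunary \<Rightarrow> bool" where
  "sigma_perfect S \<longleftrightarrow> (\<forall>a\<in>carrier S. \<forall>b\<in>carrier S.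
     set_product S (rel_sigma S `` {a}) (rel_sigma S `` {b}) = rel_sigma S `` {a \<cdot>\<^bsub>S\<^esub> b})"

definition almost_perfect :: "'a biunary \<Rightarrow> bool" where
  "almost_perfect S \<longleftrightarrow> proper S \<and> sigma_perfect S"

definition F_restriction_monoid :: "'a biunary \<Rightarrow> bool" where
  "F_restriction_monoid M \<longleftrightarrow> restriction_monoid M \<and> proper M \<and>
     (\<forall>C \<in> carrier M // rel_sigma M. \<exists>m\<in>C. \<forall>a\<in>C. a \<preceq>\<^bsub>M\<^esub> m)"

definition perfect_F_restriction_monoid :: "'a biunary \<Rightarrow> bool" where
  "perfect_F_restriction_monoid M \<longleftrightarrow> F_restriction_monoid M \<and> sigma_perfect M"

text \<open>
  A plain submonoid is a submonoid of the underlying plain monoid; it need not be closed under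
  the unary operations.
\<close>

definition T_proper :: "('t, 'm) monoid_scheme \<Rightarrow> 'a biunary \<Rightarrow> bool" where
  "T_proper T M \<longleftrightarrow> restriction_monoid M \<and>
     (\<exists>T'. submonoid T' (plain_reduct M) \<and>
           T \<cong> (plain_reduct M)\<lparr>carrier := T'\<rparr> \<and>
           carrier M = set_product M (projections M) T' \<and>
           (\<forall>t\<in>T'. \<forall>u\<in>T'. (t, u) \<in> rel_sigma M \<longrightarrow> t = u))"

definition monoidal_subhom ::
  "('t, 'm) monoid_scheme \<Rightarrow> 'a biunary \<Rightarrow> ('t \<Rightarrow> 'a) \<Rightarrow> bool" where
  "monoidal_subhom T R \<alpha> \<longleftrightarrow>
     \<alpha> \<in> carrier T \<rightarrow> carrier R \<and> \<alpha> \<one>\<^bsub>T\<^esub> = identity R \<and>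
     (\<forall>t\<in>carrier T. \<forall>u\<in>carrier T. \<alpha> t \<cdot>\<^bsub>R\<^esub> \<alpha> u \<preceq>\<^bsub>R\<^esub> \<alpha> (t \<otimes>\<^bsub>T\<^esub> u))"

definition restriction_submonoid :: "'a biunary \<Rightarrow> 'a biunary \<Rightarrow> bool" where
  "restriction_submonoid R M \<longleftrightarrow> restriction_monoid R \<and>
     carrier R \<subseteq> carrier M \<and> identity M \<in> carrier R \<and>
     (\<forall>x\<in>carrier R. \<forall>y\<in>carrier R. x \<cdot>\<^bsub>R\<^esub> y = x \<cdot>\<^bsub>M\<^esub> y) \<and>
     (\<forall>x\<in>carrier R. x\<^sup>\<oplus>\<^bsub>R\<^esub> = x\<^sup>\<oplus>\<^bsub>M\<^esub> \<and> x\<^sup>\<star>\<^bsub>R\<^esub> = x\<^sup>\<star>\<^bsub>M\<^esub>)"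

definition biunary_embedding :: "'a biunary \<Rightarrow> 'b biunary \<Rightarrow> ('a \<Rightarrow> 'b) \<Rightarrow> bool" where
  "biunary_embedding S R \<iota> \<longleftrightarrow>
     \<iota> \<in> carrier S \<rightarrow> carrier R \<and> inj_on \<iota> (carrier S) \<and>
     (\<forall>x\<in>carrier S. \<forall>y\<in>carrier S. \<iota> (x \<cdot>\<^bsub>S\<^esub> y) = \<iota> x \<cdot>\<^bsub>R\<^esub> \<iota> y) \<and>
     (\<forall>x\<in>carrier S. \<iota> (x\<^sup>\<oplus>\<^bsub>S\<^esub>) = (\<iota> x)\<^sup>\<oplus>\<^bsub>R\<^esub> \<and> \<iota> (x\<^sup>\<star>\<^bsub>S\<^esub>) = (\<iota> x)\<^sup>\<star>\<^bsub>R\<^esub>)"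

text \<open>
  The restriction monoid \<open>R\<close> contains \<open>S\<close>, and every \<open>r\<close> in \<open>R\<close> is locally in \<open>S\<close>. Containment
  is expressed by an embedding \<open>\<iota>\<close>, so that \<open>S\<close> can be identified with its image in a structure
  over another type (permissible subsets, or \<open>S\<close> with an identity adjoined); literal containment
  is the case \<open>\<iota> = id\<close>.
\<close>

definition monoid_extension :: "'a biunary \<Rightarrow> 'b biunary \<Rightarrow> ('a \<Rightarrow> 'b) \<Rightarrow> bool" where
  "monoid_extension S R \<iota> \<longleftrightarrow> restriction_monoid R \<and> biunary_embedding S R \<iota> \<and>
     (\<forall>r\<in>carrier R.
        (\<exists>e\<in>projections S. \<iota> e \<preceq>\<^bsub>R\<^esub> r\<^sup>\<oplus>\<^bsub>R\<^esub>) \<and>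
        (\<forall>e\<in>projections S. \<iota> e \<preceq>\<^bsub>R\<^esub> r\<^sup>\<oplus>\<^bsub>R\<^esub> \<longrightarrow> \<iota> e \<cdot>\<^bsub>R\<^esub> r \<in> \<iota> ` carrier S) \<and>
        (\<exists>f\<in>projections S. \<iota> f \<preceq>\<^bsub>R\<^esub> r\<^sup>\<star>\<^bsub>R\<^esub>) \<and>
        (\<forall>f\<in>projections S. \<iota> f \<preceq>\<^bsub>R\<^esub> r\<^sup>\<star>\<^bsub>R\<^esub> \<longrightarrow> r \<cdot>\<^bsub>R\<^esub> \<iota> f \<in> \<iota> ` carrier S))"

definition permissible :: "'a biunary \<Rightarrow> 'a set \<Rightarrow> bool" where
  "permissible S A \<longleftrightarrow> order_ideal S A \<and>
     (\<forall>a\<in>A. \<forall>b\<in>A. a\<^sup>\<oplus>\<^bsub>S\<^esub> \<cdot>\<^bsub>S\<^esub> b = b\<^sup>\<oplus>\<^bsub>S\<^esub> \<cdot>\<^bsub>S\<^esub> a \<and> a \<cdot>\<^bsub>S\<^esub> b\<^sup>\<star>\<^bsub>S\<^esub> = b \<cdot>\<^bsub>S\<^esub> a\<^sup>\<star>\<^bsub>S\<^esub>)"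

definition permissible_monoid :: "'a biunary \<Rightarrow> 'a set biunary" where
  "permissible_monoid S = \<lparr>carrier = {A. permissible S A}, bmult = set_product S,
     bplus = image (bplus S), bstar = image (bstar S)\<rparr>"

definition principal_ideal :: "'a biunary \<Rightarrow> 'a \<Rightarrow> 'a set" where
  "principal_ideal S a = {b \<in> carrier S. b \<preceq>\<^bsub>S\<^esub> a}"

text \<open>
  \<open>S\<^sup>1\<close>, with \<open>S\<close> embedded by \<open>Some\<close>; the identity \<open>None\<close> is adjoined only if \<open>S\<close> has no identity.
\<close>

definition adjoin_identity :: "'a biunary \<Rightarrow> 'a option biunary" where
  "adjoin_identity S = \<lparr>
     carrier = Some ` carrier S \<union> (if \<exists>u. is_identity S u then {} else {None}),
     bmult = (\<lambda>x y. case x of None \<Rightarrow> y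
                | Some a \<Rightarrow> (case y of None \<Rightarrow> x | Some b \<Rightarrow> Some (a \<cdot>\<^bsub>S\<^esub> b))),
     bplus = map_option (bplus S),
     bstar = map_option (bstar S)\<rparr>"

definition plain_as_biunary :: "('t, 'm) monoid_scheme \<Rightarrow> 't biunary" where
  "plain_as_biunary T = \<lparr>carrier = carrier T, bmult = mult T,
     bplus = (\<lambda>t. \<one>\<^bsub>T\<^esub>), bstar = (\<lambda>t. \<one>\<^bsub>T\<^esub>)\<rparr>"

definition biunary_prod :: "'a biunary \<Rightarrow> 'b biunary \<Rightarrow> ('a \<times> 'b) biunary" where
  "biunary_prod S U = \<lparr>carrier = carrier S \<times> carrier U,
     bmult = (\<lambda>(a, t) (b, u). (a \<cdot>\<^bsub>S\<^esub> b, t \<cdot>\<^bsub>U\<^esub> u)),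
     bplus = (\<lambda>(a, t). (a\<^sup>\<oplus>\<^bsub>S\<^esub>, t\<^sup>\<oplus>\<^bsub>U\<^esub>)),
     bstar = (\<lambda>(a, t). (a\<^sup>\<star>\<^bsub>S\<^esub>, t\<^sup>\<star>\<^bsub>U\<^esub>))\<rparr>"

text \<open>\<open>S\<^bsub>T,R\<^esub>\<close>, with \<open>S\<close> contained in \<open>R\<close> by means of \<open>\<iota>\<close>.\<close>

definition S_TR :: "'a biunary \<Rightarrow> 'b biunary \<Rightarrow> ('a \<Rightarrow> 'b) \<Rightarrow> ('t, 'm) monoid_scheme
    \<Rightarrow> ('t \<Rightarrow> 'b) \<Rightarrow> ('a \<times> 't) biunary" where
  "S_TR S R \<iota> T \<alpha> = (biunary_prod S (plain_as_biunary T))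
     \<lparr>carrier := {(a, t) \<in> carrier S \<times> carrier T. \<iota> a \<preceq>\<^bsub>R\<^esub> \<alpha> t}\<rparr>"

end

theory Submission
  imports Defs
begin

text \<open>
  Two elements of \<open>S\<^bsub>T,R\<^esub>\<close> are \<open>\<sigma>\<close>-related iff their second components agree, so the
  \<open>\<sigma>\<close>-classes are indexed by \<open>T\<close>, the class of \<open>t\<close> being \<open>{(a, t). a \<le> t\<alpha>}\<close>; this gives
  properness. Perfection of \<open>\<sigma>\<close> then says that each \<open>c \<in> S\<close> below \<open>(tu)\<alpha>\<close> factors as \<open>ab\<close>
  with \<open>a \<le> t\<alpha>\<close> and \<open>b \<le> u\<alpha>\<close>. If \<open>\<alpha>\<close> is a homomorphism, then
  \<open>c = (c\<^sup>+ (t\<alpha>)) ((u\<alpha>) c\<^sup>*)\<close> is such a factorisation. For the converse it is enough that an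
  element of \<open>R\<close> is determined by the elements of \<open>S\<close> below it, which holds for
  \<open>R \<le> C(S)\<close> and for \<open>R = S\<^sup>1\<close>. In the monoid case \<open>(t\<alpha>, t)\<close> is the greatest element of the
  class of \<open>t\<close>, and any submonoid witnessing \<open>T\<close>-properness has to consist of these elements.
\<close>

section \<open>Restriction semigroups\<close>

context restriction_semigroup
begin

section \<open>Projections\<close>

lemma plus_projection [simp]: "x \<in> carrier S \<Longrightarrow> x\<^sup>\<oplus> \<in> projections S"
  by (simp add: projections_def)

lemma projection_closed: "e \<in> projections S \<Longrightarrow> e \<in> carrier S"
  by (auto simp: projections_def plus_closed)

lemma projection_plus: "e \<in> projections S \<Longrightarrow> e\<^sup>\<oplus> = e"
  unfolding projections_def by (metis imageE plus_closed plus_of_star star_of_plus)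

lemma projection_star: "e \<in> projections S \<Longrightarrow> e\<^sup>\<star> = e"
  by (auto simp: projections_def star_of_plus)

lemma star_projection [simp]: "x \<in> carrier S \<Longrightarrow> x\<^sup>\<star> \<in> projections S"
  by (metis plus_of_star plus_projection star_closed)

lemma projection_idem: "e \<in> projections S \<Longrightarrow> e \<cdot> e = e"
  by (metis plus_left projection_closed projection_plus)

lemma projection_comm: "\<lbrakk>e \<in> projections S; f \<in> projections S\<rbrakk> \<Longrightarrow> e \<cdot> f = f \<cdot> e"
  by (metis plus_comm projection_closed projection_plus)

lemma projection_mult: "\<lbrakk>e \<in> projections S; f \<in> projections S\<rbrakk> \<Longrightarrow> e \<cdot> f \<in> projections S"
  by (metis mult_closed plus_plus plus_projection projection_closed projection_plus)

lemma plus_projection_mult: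
  "\<lbrakk>e \<in> projections S; x \<in> carrier S\<rbrakk> \<Longrightarrow> (e \<cdot> x)\<^sup>\<oplus> = e \<cdot> x\<^sup>\<oplus>"
  by (metis plus_plus projection_closed projection_plus)

section \<open>The natural partial order\<close>

lemma le_closed: "\<lbrakk>a \<preceq> b; b \<in> carrier S\<rbrakk> \<Longrightarrow> a \<in> carrier S"
  by (auto simp: nat_le_def projection_closed mult_closed)

text \<open>If a = eb with e a projection, then a^+ = e b^+ and so a^+ b = e b^+ b = a. Thus a^+ can
  replace the unspecified projection in the definition of the order.\<close>

lemma le_eq_plus: "\<lbrakk>a \<preceq> b; b \<in> carrier S\<rbrakk> \<Longrightarrow> a = a\<^sup>\<oplus> \<cdot> b"
  unfolding nat_le_def
  by (metis assoc plus_closed plus_left plus_projection_mult projection_closed)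

text \<open>For a = eb the dual ample identity turns eb into b (eb)^* = b a^*, which makes the order
  left-right symmetric.\<close>

lemma le_eq_star: "\<lbrakk>a \<preceq> b; b \<in> carrier S\<rbrakk> \<Longrightarrow> a = b \<cdot> a\<^sup>\<star>"
  unfolding nat_le_def
  by (metis projection_closed projection_star star_ample)

lemma projection_mult_le: "e \<in> projections S \<Longrightarrow> e \<cdot> b \<preceq> b"
  by (auto simp: nat_le_def)

text \<open>The ample identity moves f to the left: bf = (bf)^+ b.\<close>

lemma mult_projection_le:
  assumes "f \<in> projections S" "b \<in> carrier S"
  shows "b \<cdot> f \<preceq> b"
  using assms unfolding nat_le_def
  by (metis mult_closed plus_ample plus_projection projection_closed projection_plus)

lemma le_refl: "a \<in> carrier S \<Longrightarrow> a \<preceq> a"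
  by (metis nat_le_def plus_left plus_projection)

lemma le_trans: "\<lbrakk>a \<preceq> b; b \<preceq> c; c \<in> carrier S\<rbrakk> \<Longrightarrow> a \<preceq> c"
  unfolding nat_le_def by (metis assoc projection_closed projection_mult)

lemma le_antisym:
  assumes "a \<preceq> b" "b \<preceq> a" "a \<in> carrier S" "b \<in> carrier S"
  shows "a = b"
proof -
  have "a = a\<^sup>\<oplus> \<cdot> (b\<^sup>\<oplus> \<cdot> a)"
    using assms le_eq_plus by metis
  also have "\<dots> = b\<^sup>\<oplus> \<cdot> (a\<^sup>\<oplus> \<cdot> a)"
    using assms by (metis assoc plus_closed plus_comm)
  also have "\<dots> = b"
    using assms le_eq_plus plus_left by metis
  finally show ?thesis .
qed

lemma le_mult_mono:
  assumes "a \<preceq> c" "b \<preceq> d" and c: "c \<in> carrier S" and d: "d \<in> carrier S"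
  shows "a \<cdot> b \<preceq> c \<cdot> d"
proof -
  obtain e f where e: "e \<in> projections S" "a = e \<cdot> c" and f: "f \<in> projections S" "b = f \<cdot> d"
    using assms by (auto simp: nat_le_def)
  have cl: "e \<in> carrier S" "f \<in> carrier S" "c \<cdot> f \<in> carrier S" "(c \<cdot> f)\<^sup>\<oplus> \<in> carrier S"
    using e f c by (auto simp: projection_closed mult_closed plus_closed)
  \<comment> \<open>In ab = e c f d the projection f stands in the middle; the ample identity moves
    it in front of c as (cf)^+, where it joins e.\<close>
  have "c \<cdot> f = (c \<cdot> f)\<^sup>\<oplus> \<cdot> c"
    using plus_ample[OF c cl(2)] f projection_plus by simp
  then have "a \<cdot> b = e \<cdot> (((c \<cdot> f)\<^sup>\<oplus> \<cdot> c) \<cdot> d)"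
    using e f c d cl by (simp add: assoc mult_closed)
  also have "\<dots> = (e \<cdot> (c \<cdot> f)\<^sup>\<oplus>) \<cdot> (c \<cdot> d)"
    using c d cl by (simp add: assoc mult_closed)
  finally show ?thesis
    using e cl projection_mult plus_projection nat_le_def by metis
qed

lemma le_plus_mono: "\<lbrakk>a \<preceq> b; b \<in> carrier S\<rbrakk> \<Longrightarrow> a\<^sup>\<oplus> \<preceq> b\<^sup>\<oplus>"
  unfolding nat_le_def using plus_projection_mult by metis

lemma le_star_mono: "\<lbrakk>a \<preceq> b; b \<in> carrier S\<rbrakk> \<Longrightarrow> a\<^sup>\<star> \<preceq> b\<^sup>\<star>"
  by (metis le_closed le_eq_star nat_le_def star_comm star_projection star_star)

lemma identity_unique: "\<lbrakk>is_identity S u; is_identity S v\<rbrakk> \<Longrightarrow> u = v"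
  unfolding is_identity_def by metis

lemma identity_eqI: "is_identity S u \<Longrightarrow> identity S = u"
  unfolding identity_def using identity_unique by blast

end

lemma restriction_monoid_identity: "restriction_monoid S \<Longrightarrow> is_identity S (identity S)"
  unfolding restriction_monoid_def using restriction_semigroup.identity_eqI by metis

section \<open>The semigroup of a monoidal subhomomorphism\<close>

text \<open>The embedding \<iota> stays arbitrary, so that the instances
  \<open>principal_ideal S\<close>, \<open>Some\<close> and \<open>id\<close> cover permissible
  subsets, S with an identity adjoined, and the monoid case.\<close>

locale subhom_extension =
  S: restriction_semigroup S + T: monoid T
  for S :: "'a biunary" and T :: "('t, 'm) monoid_scheme" +
  fixes R :: "'b biunary" and \<iota> :: "'a \<Rightarrow> 'b" and \<alpha> :: "'t \<Rightarrow> 'b"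
  assumes extension: "monoid_extension S R \<iota>"
    and subhom: "monoidal_subhom T R \<alpha>"
begin

abbreviation M where "M \<equiv> S_TR S R \<iota> T \<alpha>"

section \<open>Elementary properties of \<iota> and \<alpha>\<close>

lemma R_monoid: "restriction_monoid R"
  using extension by (simp add: monoid_extension_def)

sublocale R: restriction_semigroup R
  using R_monoid by (simp add: restriction_monoid_def)

lemma iota_closed [simp]: "a \<in> carrier S \<Longrightarrow> \<iota> a \<in> carrier R"
  using extension by (auto simp: monoid_extension_def biunary_embedding_def)

lemma iota_eq_iff: "\<lbrakk>a \<in> carrier S; b \<in> carrier S\<rbrakk> \<Longrightarrow> \<iota> a = \<iota> b \<longleftrightarrow> a = b"
  using extension by (auto simp: monoid_extension_def biunary_embedding_def inj_on_def)

lemma iota_mult [simp]: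
  "\<lbrakk>a \<in> carrier S; b \<in> carrier S\<rbrakk> \<Longrightarrow> \<iota> (a \<cdot>\<^bsub>S\<^esub> b) = \<iota> a \<cdot>\<^bsub>R\<^esub> \<iota> b"
  using extension by (auto simp: monoid_extension_def biunary_embedding_def)

lemma iota_plus [simp]: "a \<in> carrier S \<Longrightarrow> \<iota> (a\<^sup>\<oplus>\<^bsub>S\<^esub>) = (\<iota> a)\<^sup>\<oplus>\<^bsub>R\<^esub>"
  using extension by (auto simp: monoid_extension_def biunary_embedding_def)

lemma iota_star [simp]: "a \<in> carrier S \<Longrightarrow> \<iota> (a\<^sup>\<star>\<^bsub>S\<^esub>) = (\<iota> a)\<^sup>\<star>\<^bsub>R\<^esub>"
  using extension by (auto simp: monoid_extension_def biunary_embedding_def)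

lemma alpha_closed [simp]: "t \<in> carrier T \<Longrightarrow> \<alpha> t \<in> carrier R"
  using subhom by (auto simp: monoidal_subhom_def)

lemma alpha_one: "is_identity R (\<alpha> \<one>\<^bsub>T\<^esub>)"
  using subhom restriction_monoid_identity[OF R_monoid] by (simp add: monoidal_subhom_def)

lemma alpha_mult_le:
  "\<lbrakk>t \<in> carrier T; u \<in> carrier T\<rbrakk> \<Longrightarrow> \<alpha> t \<cdot>\<^bsub>R\<^esub> \<alpha> u \<preceq>\<^bsub>R\<^esub> \<alpha> (t \<otimes>\<^bsub>T\<^esub> u)"
  using subhom by (auto simp: monoidal_subhom_def)

lemma projection_le_alpha_one: "e \<in> projections R \<Longrightarrow> e \<preceq>\<^bsub>R\<^esub> \<alpha> \<one>\<^bsub>T\<^esub>"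
  using alpha_one unfolding nat_le_def is_identity_def by (metis R.projection_closed)

section \<open>The restriction semigroup structure of \<open>M\<close>\<close>

lemma M_mult [simp]: "(a, t) \<cdot>\<^bsub>M\<^esub> (b, u) = (a \<cdot>\<^bsub>S\<^esub> b, t \<otimes>\<^bsub>T\<^esub> u)"
  by (simp add: S_TR_def biunary_prod_def plain_as_biunary_def)

lemma M_plus [simp]: "(a, t)\<^sup>\<oplus>\<^bsub>M\<^esub> = (a\<^sup>\<oplus>\<^bsub>S\<^esub>, \<one>\<^bsub>T\<^esub>)"
  by (simp add: S_TR_def biunary_prod_def plain_as_biunary_def)

lemma M_star [simp]: "(a, t)\<^sup>\<star>\<^bsub>M\<^esub> = (a\<^sup>\<star>\<^bsub>S\<^esub>, \<one>\<^bsub>T\<^esub>)"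
  by (simp add: S_TR_def biunary_prod_def plain_as_biunary_def)

lemma M_carrier [simp]:
  "(a, t) \<in> carrier M \<longleftrightarrow> a \<in> carrier S \<and> t \<in> carrier T \<and> \<iota> a \<preceq>\<^bsub>R\<^esub> \<alpha> t"
  by (auto simp: S_TR_def biunary_prod_def plain_as_biunary_def)

text \<open>The subhomomorphism inequality supplies the last step of ab \<le> (t\<alpha>)(u\<alpha>)
  \<le> (tu)\<alpha>.\<close>

lemma M_mult_closed:
  assumes "(a, t) \<in> carrier M" "(b, u) \<in> carrier M"
  shows "(a \<cdot>\<^bsub>S\<^esub> b, t \<otimes>\<^bsub>T\<^esub> u) \<in> carrier M"
proof -
  have "\<iota> a \<cdot>\<^bsub>R\<^esub> \<iota> b \<preceq>\<^bsub>R\<^esub> \<alpha> t \<cdot>\<^bsub>R\<^esub> \<alpha> u"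
    using assms by (auto intro!: R.le_mult_mono)
  then have "\<iota> a \<cdot>\<^bsub>R\<^esub> \<iota> b \<preceq>\<^bsub>R\<^esub> \<alpha> (t \<otimes>\<^bsub>T\<^esub> u)"
    using assms by (intro R.le_trans[OF _ alpha_mult_le]) auto
  then show ?thesis
    using assms by (auto simp: S.mult_closed)
qed

text \<open>Closure of \<open>M\<close> under both unary operations rests on this, since their
  values have the form (e, 1). The reason is that 1\<alpha> is the identity of \<open>R\<close>,
  which lies above every projection.\<close>

lemma M_projection: "e \<in> projections S \<Longrightarrow> (e, \<one>\<^bsub>T\<^esub>) \<in> carrier M"
  using projection_le_alpha_one S.projection_closed S.projection_plus iota_plus iota_closed
    R.plus_projection by (metis M_carrier T.one_closed)

lemma projections_M: "projections M = (\<lambda>e. (e, \<one>\<^bsub>T\<^esub>)) ` projections S"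
proof (intro equalityI subsetI)
  fix p assume "p \<in> projections M"
  then show "p \<in> (\<lambda>e. (e, \<one>\<^bsub>T\<^esub>)) ` projections S"
    by (auto simp: projections_def)
next
  fix p assume "p \<in> (\<lambda>e. (e, \<one>\<^bsub>T\<^esub>)) ` projections S"
  then obtain e where e: "e \<in> projections S" "p = (e, \<one>\<^bsub>T\<^esub>)"
    by auto
  then have "p = p\<^sup>\<oplus>\<^bsub>M\<^esub>"
    by (simp add: S.projection_plus)
  then show "p \<in> projections M"
    using e M_projection unfolding projections_def by blast
qed

lemma restriction_semigroup_M: "restriction_semigroup M"
proof
  obtain a where "a \<in> carrier S"
    using S.nonempty by auto
  then show "carrier M \<noteq> {}"
    using M_projection[OF S.plus_projection] by blast
next
  fix x y assume "x \<in> carrier M" "y \<in> carrier M"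
  then show "x \<cdot>\<^bsub>M\<^esub> y \<in> carrier M"
    using M_mult_closed by (cases x; cases y) (metis M_mult)
next
  fix x assume "x \<in> carrier M"
  moreover obtain a t where "x = (a, t)"
    by fastforce
  ultimately show "x\<^sup>\<oplus>\<^bsub>M\<^esub> \<in> carrier M" "x\<^sup>\<star>\<^bsub>M\<^esub> \<in> carrier M"
    using M_projection S.plus_projection S.star_projection by (auto simp del: iota_plus iota_star)
\<comment> \<open>The identities hold coordinatewise: in the first they are those of
  \<open>S\<close>; in the second the unary operations are constantly 1, so the laws of the monoid
  \<open>T\<close> suffice.\<close>
qed (auto simp del: iota_mult iota_plus iota_star
      simp: S.assoc T.m_assoc S.plus_left S.plus_plus S.star_right S.star_star
        S.star_of_plus S.plus_of_star S.plus_closed S.star_closed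
      intro: S.plus_comm S.plus_ample S.star_comm S.star_ample)

section \<open>The congruence \<sigma> and properness\<close>

lemma sigma_M: "rel_sigma M = {(x, y). x \<in> carrier M \<and> y \<in> carrier M \<and> snd x = snd y}"
proof (intro equalityI subsetI)
  fix p assume "p \<in> rel_sigma M"
  \<comment> \<open>Projections of \<open>M\<close> have second coordinate 1, so multiplying by one
    preserves second coordinates.\<close>
  then show "p \<in> {(x, y). x \<in> carrier M \<and> y \<in> carrier M \<and> snd x = snd y}"
    by (auto simp: rel_sigma_def projections_M)
next
  fix p assume "p \<in> {(x, y). x \<in> carrier M \<and> y \<in> carrier M \<and> snd x = snd y}"
  then obtain a b t where p: "p = ((a, t), (b, t))" "(a, t) \<in> carrier M" "(b, t) \<in> carrier M"
    by (cases p) auto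
  then have cl [simp]: "a \<in> carrier S" "b \<in> carrier S" "t \<in> carrier T"
    and le: "\<iota> a \<preceq>\<^bsub>R\<^esub> \<alpha> t" "\<iota> b \<preceq>\<^bsub>R\<^esub> \<alpha> t"
    by auto
  \<comment> \<open>As a = a^+ (t\<alpha>) and b = b^+ (t\<alpha>), multiplying either by a^+ b^+
    gives a^+ b^+ (t\<alpha>).\<close>
  define e where "e = a\<^sup>\<oplus>\<^bsub>S\<^esub> \<cdot>\<^bsub>S\<^esub> b\<^sup>\<oplus>\<^bsub>S\<^esub>"
  have e: "e \<in> projections S"
    by (simp add: e_def S.projection_mult)
  have cl': "(\<iota> a)\<^sup>\<oplus>\<^bsub>R\<^esub> \<in> carrier R" "(\<iota> b)\<^sup>\<oplus>\<^bsub>R\<^esub> \<in> carrier R"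
    by (simp_all add: R.plus_closed)
  have idem: "(\<iota> a)\<^sup>\<oplus>\<^bsub>R\<^esub> \<cdot>\<^bsub>R\<^esub> (\<iota> a)\<^sup>\<oplus>\<^bsub>R\<^esub> = (\<iota> a)\<^sup>\<oplus>\<^bsub>R\<^esub>" "(\<iota> b)\<^sup>\<oplus>\<^bsub>R\<^esub> \<cdot>\<^bsub>R\<^esub> (\<iota> b)\<^sup>\<oplus>\<^bsub>R\<^esub> = (\<iota> b)\<^sup>\<oplus>\<^bsub>R\<^esub>"
    by (simp_all add: R.projection_idem)
  have comm: "(\<iota> a)\<^sup>\<oplus>\<^bsub>R\<^esub> \<cdot>\<^bsub>R\<^esub> (\<iota> b)\<^sup>\<oplus>\<^bsub>R\<^esub> = (\<iota> b)\<^sup>\<oplus>\<^bsub>R\<^esub> \<cdot>\<^bsub>R\<^esub> (\<iota> a)\<^sup>\<oplus>\<^bsub>R\<^esub>"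
    by (simp add: R.plus_comm)
  \<comment> \<open>The computation runs in \<open>R\<close>, because t\<alpha> need not come from
    \<open>S\<close>; injectivity of \<iota> then brings the equation back to
    \<open>S\<close>.\<close>
  have "\<iota> (e \<cdot>\<^bsub>S\<^esub> a) = (\<iota> a)\<^sup>\<oplus>\<^bsub>R\<^esub> \<cdot>\<^bsub>R\<^esub> (\<iota> b)\<^sup>\<oplus>\<^bsub>R\<^esub> \<cdot>\<^bsub>R\<^esub> ((\<iota> a)\<^sup>\<oplus>\<^bsub>R\<^esub> \<cdot>\<^bsub>R\<^esub> \<alpha> t)"
    using R.le_eq_plus[OF le(1)] by (simp add: e_def S.plus_closed S.mult_closed)
  also have "\<dots> = (\<iota> a)\<^sup>\<oplus>\<^bsub>R\<^esub> \<cdot>\<^bsub>R\<^esub> (\<iota> b)\<^sup>\<oplus>\<^bsub>R\<^esub> \<cdot>\<^bsub>R\<^esub> \<alpha> t"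
    using cl' idem comm by (metis (no_types, lifting) R.assoc R.mult_closed alpha_closed cl(3))
  also have "\<dots> = (\<iota> a)\<^sup>\<oplus>\<^bsub>R\<^esub> \<cdot>\<^bsub>R\<^esub> (\<iota> b)\<^sup>\<oplus>\<^bsub>R\<^esub> \<cdot>\<^bsub>R\<^esub> ((\<iota> b)\<^sup>\<oplus>\<^bsub>R\<^esub> \<cdot>\<^bsub>R\<^esub> \<alpha> t)"
    using cl' idem by (metis (no_types, lifting) R.assoc R.mult_closed alpha_closed cl(3))
  also have "\<dots> = \<iota> (e \<cdot>\<^bsub>S\<^esub> b)"
    using R.le_eq_plus[OF le(2)] by (simp add: e_def S.plus_closed S.mult_closed)
  finally have "e \<cdot>\<^bsub>S\<^esub> a = e \<cdot>\<^bsub>S\<^esub> b"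
    using e by (subst (asm) iota_eq_iff) (auto simp: S.mult_closed S.projection_closed)
  then show "p \<in> rel_sigma M"
    using p e by (auto simp: rel_sigma_def projections_M)
qed

text \<open>All elements of one \<sigma>-class lie below the same t\<alpha>, and a = a^+ (t\<alpha>)
  = (t\<alpha>) a^* recovers a from either a^+ or a^*.\<close>

lemma proper_M: "proper M"
proof -
  interpret M: restriction_semigroup M
    by (rule restriction_semigroup_M)
  have "a = b" if "(a, t) \<in> carrier M" "(b, t) \<in> carrier M" "a\<^sup>\<oplus>\<^bsub>S\<^esub> = b\<^sup>\<oplus>\<^bsub>S\<^esub>" for a b t
    using that R.le_eq_plus M_carrier alpha_closed iota_eq_iff iota_plus by metis
  moreover
  have "a = b" if "(a, t) \<in> carrier M" "(b, t) \<in> carrier M" "a\<^sup>\<star>\<^bsub>S\<^esub> = b\<^sup>\<star>\<^bsub>S\<^esub>" for a b t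
    using that R.le_eq_star M_carrier alpha_closed iota_eq_iff iota_star by metis
  ultimately show ?thesis
    unfolding proper_def sigma_M rel_R_def rel_L_def
    using restriction_semigroup_M by (auto simp: Id_on_iff simp del: M_carrier)
qed

section \<open>Perfection of \<sigma>\<close>

lemma class_nonempty:
  assumes "t \<in> carrier T"
  obtains a where "(a, t) \<in> carrier M"
proof -
  \<comment> \<open>The extension hypothesis gives a projection e of \<open>S\<close> below
    (t\<alpha>)^+; then e (t\<alpha>) comes from \<open>S\<close> and lies below t\<alpha>.\<close>
  obtain e where e: "e \<in> projections S" "\<iota> e \<preceq>\<^bsub>R\<^esub> (\<alpha> t)\<^sup>\<oplus>\<^bsub>R\<^esub>" "\<iota> e \<cdot>\<^bsub>R\<^esub> \<alpha> t \<in> \<iota> ` carrier S"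
    using extension alpha_closed[OF assms] unfolding monoid_extension_def by blast
  then obtain a where a: "a \<in> carrier S" "\<iota> a = \<iota> e \<cdot>\<^bsub>R\<^esub> \<alpha> t"
    by force
  have "\<iota> e \<in> projections R"
    using e(1) by (metis R.plus_projection S.projection_closed S.projection_plus iota_closed iota_plus)
  then have "(a, t) \<in> carrier M"
    using a assms by (simp add: R.projection_mult_le)
  then show ?thesis
    by (rule that)
qed

text \<open>The product of the classes of t and u always lies in the class of tu. Perfection is
  therefore the reverse inclusion, a factorisation property in \<open>S\<close>.\<close>

lemma sigma_perfect_iff:
  "sigma_perfect M \<longleftrightarrow>
     (\<forall>t\<in>carrier T. \<forall>u\<in>carrier T. \<forall>c. (c, t \<otimes>\<^bsub>T\<^esub> u) \<in> carrier M \<longrightarrow>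
        (\<exists>a b. (a, t) \<in> carrier M \<and> (b, u) \<in> carrier M \<and> c = a \<cdot>\<^bsub>S\<^esub> b))"
    (is "?perfect \<longleftrightarrow> ?factors")
proof
  assume perfect: ?perfect
  show ?factors
  proof (intro ballI allI impI)
    fix t u c
    assume t: "t \<in> carrier T" and u: "u \<in> carrier T" and c: "(c, t \<otimes>\<^bsub>T\<^esub> u) \<in> carrier M"
    \<comment> \<open>Perfection speaks of classes of elements of \<open>M\<close>, so t and u first
      need representatives.\<close>
    obtain a b where a: "(a, t) \<in> carrier M" and b: "(b, u) \<in> carrier M"
      using class_nonempty t u by metis
    have "(c, t \<otimes>\<^bsub>T\<^esub> u) \<in> rel_sigma M `` {(a, t) \<cdot>\<^bsub>M\<^esub> (b, u)}"
      using c M_mult_closed[OF a b] by (auto simp: sigma_M simp del: M_carrier)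
    then have "(c, t \<otimes>\<^bsub>T\<^esub> u) \<in> set_product M (rel_sigma M `` {(a, t)}) (rel_sigma M `` {(b, u)})"
      using perfect a b unfolding sigma_perfect_def by blast
    then show "\<exists>a b. (a, t) \<in> carrier M \<and> (b, u) \<in> carrier M \<and> c = a \<cdot>\<^bsub>S\<^esub> b"
      by (auto simp: set_product_def sigma_M simp del: M_carrier)
  qed
next
  assume factors: ?factors
  show ?perfect
    unfolding sigma_perfect_def
  proof (intro ballI)
    fix x y assume "x \<in> carrier M" "y \<in> carrier M"
    moreover obtain a t b u where "x = (a, t)" "y = (b, u)"
      by fastforce
    ultimately have x: "x = (a, t)" "(a, t) \<in> carrier M" and y: "y = (b, u)" "(b, u) \<in> carrier M"
      by auto
    then have tu: "t \<in> carrier T" "u \<in> carrier T"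
      by auto
    have "set_product M (rel_sigma M `` {x}) (rel_sigma M `` {y}) \<subseteq> rel_sigma M `` {x \<cdot>\<^bsub>M\<^esub> y}"
      using x y M_mult_closed by (auto simp: set_product_def sigma_M simp del: M_carrier)
    moreover have "z \<in> set_product M (rel_sigma M `` {x}) (rel_sigma M `` {y})"
      if "z \<in> rel_sigma M `` {x \<cdot>\<^bsub>M\<^esub> y}" for z
    proof -
      obtain c where z: "z = (c, t \<otimes>\<^bsub>T\<^esub> u)" "(c, t \<otimes>\<^bsub>T\<^esub> u) \<in> carrier M"
        using \<open>z \<in> _\<close> x y by (cases z) (auto simp: sigma_M simp del: M_carrier)
      then obtain a' b' where ab: "(a', t) \<in> carrier M" "(b', u) \<in> carrier M" "c = a' \<cdot>\<^bsub>S\<^esub> b'"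
        using factors tu by blast
      then have "(a', t) \<in> rel_sigma M `` {x}" "(b', u) \<in> rel_sigma M `` {y}"
        using x y by (simp_all add: sigma_M del: M_carrier)
      moreover have "z = (a', t) \<cdot>\<^bsub>M\<^esub> (b', u)"
        using z ab by simp
      ultimately show ?thesis
        unfolding set_product_def by blast
    qed
    ultimately show "set_product M (rel_sigma M `` {x}) (rel_sigma M `` {y}) = rel_sigma M `` {x \<cdot>\<^bsub>M\<^esub> y}"
      by blast
  qed
qed

text \<open>Membership in \<open>hom\<close> is multiplicativity; preservation of 1 is already part
  of \<open>subhom\<close>.\<close>

lemma hom_iff:
  "\<alpha> \<in> hom T (plain_reduct R) \<longleftrightarrow>
     (\<forall>t\<in>carrier T. \<forall>u\<in>carrier T. \<alpha> (t \<otimes>\<^bsub>T\<^esub> u) = \<alpha> t \<cdot>\<^bsub>R\<^esub> \<alpha> u)"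
  by (auto simp: hom_def plain_reduct_def)

lemma hom_imp_sigma_perfect:
  assumes "\<alpha> \<in> hom T (plain_reduct R)"
  shows "sigma_perfect M"
  unfolding sigma_perfect_iff
proof (intro ballI allI impI)
  fix t u c
  assume t: "t \<in> carrier T" and u: "u \<in> carrier T" and cM: "(c, t \<otimes>\<^bsub>T\<^esub> u) \<in> carrier M"
  let ?r = "\<alpha> t" and ?s = "\<alpha> u"
  have r: "?r \<in> carrier R" and s: "?s \<in> carrier R" and c: "c \<in> carrier S"
    using t u cM by auto
  have le: "\<iota> c \<preceq>\<^bsub>R\<^esub> ?r \<cdot>\<^bsub>R\<^esub> ?s"
    using assms t u cM by (simp add: hom_iff)
  have rs: "?r \<cdot>\<^bsub>R\<^esub> ?s \<in> carrier R"
    using r s by (rule R.mult_closed)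
  have cl: "(\<iota> c)\<^sup>\<oplus>\<^bsub>R\<^esub> \<in> carrier R" "(\<iota> c)\<^sup>\<star>\<^bsub>R\<^esub> \<in> carrier R"
    using c by (simp_all add: R.plus_closed R.star_closed)
  have eq: "\<iota> c = ((\<iota> c)\<^sup>\<oplus>\<^bsub>R\<^esub> \<cdot>\<^bsub>R\<^esub> ?r) \<cdot>\<^bsub>R\<^esub> (?s \<cdot>\<^bsub>R\<^esub> (\<iota> c)\<^sup>\<star>\<^bsub>R\<^esub>)"
  proof -
    have "\<iota> c = \<iota> c \<cdot>\<^bsub>R\<^esub> (\<iota> c)\<^sup>\<star>\<^bsub>R\<^esub>"
      using c by (simp add: R.star_right)
    also have "\<dots> = ((\<iota> c)\<^sup>\<oplus>\<^bsub>R\<^esub> \<cdot>\<^bsub>R\<^esub> (?r \<cdot>\<^bsub>R\<^esub> ?s)) \<cdot>\<^bsub>R\<^esub> (\<iota> c)\<^sup>\<star>\<^bsub>R\<^esub>"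
      using R.le_eq_plus[OF le rs] by simp
    also have "\<dots> = ((\<iota> c)\<^sup>\<oplus>\<^bsub>R\<^esub> \<cdot>\<^bsub>R\<^esub> ?r) \<cdot>\<^bsub>R\<^esub> (?s \<cdot>\<^bsub>R\<^esub> (\<iota> c)\<^sup>\<star>\<^bsub>R\<^esub>)"
      using cl r s by (simp add: R.assoc R.mult_closed)
    finally show ?thesis .
  qed
  \<comment> \<open>The extension hypothesis puts c^+ r into \<open>S\<close> once c^+ \<le> r^+ is
    known. This comes from c^+ \<le> (rs)^+ \<le> r^+, and the dual chain serves the other
    factor.\<close>
  have plus_le: "(?r \<cdot>\<^bsub>R\<^esub> ?s)\<^sup>\<oplus>\<^bsub>R\<^esub> \<preceq>\<^bsub>R\<^esub> ?r\<^sup>\<oplus>\<^bsub>R\<^esub>"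
  proof -
    have "?r\<^sup>\<oplus>\<^bsub>R\<^esub> \<cdot>\<^bsub>R\<^esub> (?r \<cdot>\<^bsub>R\<^esub> ?s)\<^sup>\<oplus>\<^bsub>R\<^esub> = (?r \<cdot>\<^bsub>R\<^esub> ?s)\<^sup>\<oplus>\<^bsub>R\<^esub>"
      using r s by (metis R.assoc R.mult_closed R.plus_closed R.plus_left R.plus_plus)
    then show ?thesis
      using r rs R.plus_comm R.plus_projection unfolding nat_le_def by metis
  qed
  have star_le: "(?r \<cdot>\<^bsub>R\<^esub> ?s)\<^sup>\<star>\<^bsub>R\<^esub> \<preceq>\<^bsub>R\<^esub> ?s\<^sup>\<star>\<^bsub>R\<^esub>"
  proof -
    have "(?r \<cdot>\<^bsub>R\<^esub> ?s)\<^sup>\<star>\<^bsub>R\<^esub> \<cdot>\<^bsub>R\<^esub> ?s\<^sup>\<star>\<^bsub>R\<^esub> = (?r \<cdot>\<^bsub>R\<^esub> ?s)\<^sup>\<star>\<^bsub>R\<^esub>"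
      using r s by (metis R.assoc R.mult_closed R.star_closed R.star_right R.star_star)
    then show ?thesis
      using rs R.star_projection unfolding nat_le_def by metis
  qed
  have "\<iota> (c\<^sup>\<oplus>\<^bsub>S\<^esub>) \<preceq>\<^bsub>R\<^esub> ?r\<^sup>\<oplus>\<^bsub>R\<^esub>" "\<iota> (c\<^sup>\<star>\<^bsub>S\<^esub>) \<preceq>\<^bsub>R\<^esub> ?s\<^sup>\<star>\<^bsub>R\<^esub>"
    using c r s R.le_trans[OF R.le_plus_mono[OF le rs] plus_le]
      R.le_trans[OF R.le_star_mono[OF le rs] star_le]
    by (simp_all add: R.plus_closed R.star_closed)
  then have "\<iota> (c\<^sup>\<oplus>\<^bsub>S\<^esub>) \<cdot>\<^bsub>R\<^esub> ?r \<in> \<iota> ` carrier S" "?s \<cdot>\<^bsub>R\<^esub> \<iota> (c\<^sup>\<star>\<^bsub>S\<^esub>) \<in> \<iota> ` carrier S"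
    using extension r s S.plus_projection[OF c] S.star_projection[OF c]
    unfolding monoid_extension_def by blast+
  then obtain a b where a: "a \<in> carrier S" "\<iota> a = (\<iota> c)\<^sup>\<oplus>\<^bsub>R\<^esub> \<cdot>\<^bsub>R\<^esub> ?r"
    and b: "b \<in> carrier S" "\<iota> b = ?s \<cdot>\<^bsub>R\<^esub> (\<iota> c)\<^sup>\<star>\<^bsub>R\<^esub>"
    using c by auto
  have "(a, t) \<in> carrier M" "(b, u) \<in> carrier M"
    using a b c s t u by (simp_all add: R.projection_mult_le R.mult_projection_le)
  moreover have "c = a \<cdot>\<^bsub>S\<^esub> b"
    using a b c eq iota_eq_iff S.mult_closed iota_mult by metis
  ultimately show "\<exists>a b. (a, t) \<in> carrier M \<and> (b, u) \<in> carrier M \<and> c = a \<cdot>\<^bsub>S\<^esub> b"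
    by blast
qed

text \<open>The hypothesis \<open>determined\<close> isolates what differs between the choices of
  \<open>R\<close>. Given perfection, each c of \<open>S\<close> below (tu)\<alpha> factors as ab
  and so lies below (t\<alpha>)(u\<alpha>); \<open>determined\<close> lifts this to (tu)\<alpha>,
  and antisymmetry with the subhomomorphism inequality gives equality.\<close>

lemma almost_perfect_iff_hom:
  assumes determined: "\<And>r s. \<lbrakk>r \<in> carrier R; s \<in> carrier R;
      \<And>c. \<lbrakk>c \<in> carrier S; \<iota> c \<preceq>\<^bsub>R\<^esub> r\<rbrakk> \<Longrightarrow> \<iota> c \<preceq>\<^bsub>R\<^esub> s\<rbrakk> \<Longrightarrow> r \<preceq>\<^bsub>R\<^esub> s"
  shows "almost_perfect M \<longleftrightarrow> \<alpha> \<in> hom T (plain_reduct R)"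
proof
  assume "almost_perfect M"
  then have perfect: "sigma_perfect M"
    by (simp add: almost_perfect_def)
  have "\<alpha> (t \<otimes>\<^bsub>T\<^esub> u) = \<alpha> t \<cdot>\<^bsub>R\<^esub> \<alpha> u" if t: "t \<in> carrier T" and u: "u \<in> carrier T" for t u
  proof (rule R.le_antisym)
    show "\<alpha> (t \<otimes>\<^bsub>T\<^esub> u) \<preceq>\<^bsub>R\<^esub> \<alpha> t \<cdot>\<^bsub>R\<^esub> \<alpha> u"
    proof (rule determined)
      fix c assume "c \<in> carrier S" "\<iota> c \<preceq>\<^bsub>R\<^esub> \<alpha> (t \<otimes>\<^bsub>T\<^esub> u)"
      then have "(c, t \<otimes>\<^bsub>T\<^esub> u) \<in> carrier M"
        using t u by simp
      then obtain a b where "(a, t) \<in> carrier M" "(b, u) \<in> carrier M" "c = a \<cdot>\<^bsub>S\<^esub> b"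
        using perfect t u unfolding sigma_perfect_iff by blast
      then show "\<iota> c \<preceq>\<^bsub>R\<^esub> \<alpha> t \<cdot>\<^bsub>R\<^esub> \<alpha> u"
        by (simp add: R.le_mult_mono)
    qed (use t u in \<open>simp_all add: R.mult_closed\<close>)
  qed (use t u in \<open>simp_all add: alpha_mult_le R.mult_closed\<close>)
  then show "\<alpha> \<in> hom T (plain_reduct R)"
    by (simp add: hom_iff)
next
  assume "\<alpha> \<in> hom T (plain_reduct R)"
  then show "almost_perfect M"
    by (simp add: almost_perfect_def proper_M hom_imp_sigma_perfect)
qed

end

section \<open>Permissible subsets\<close>

text \<open>A projection witnessing the order of \<open>R\<close> has to lie in \<open>R\<close>.
  For A contained in B the witness is A^+, which \<open>R\<close> contains by closure, so
  \<open>R\<close> inherits the inclusion order of C(S).\<close>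

lemma permissible_submonoid_le_iff:
  assumes "restriction_semigroup S" and sub: "restriction_submonoid R (permissible_monoid S)"
    and A: "A \<in> carrier R" and B: "B \<in> carrier R"
  shows "A \<preceq>\<^bsub>R\<^esub> B \<longleftrightarrow> A \<subseteq> B"
proof -
  interpret S: restriction_semigroup S by fact
  interpret R: restriction_semigroup R
    using sub by (simp add: restriction_submonoid_def restriction_monoid_def)
  have mult: "X \<cdot>\<^bsub>R\<^esub> Y = set_product S X Y" if "X \<in> carrier R" "Y \<in> carrier R" for X Y
    using sub that by (simp add: restriction_submonoid_def permissible_monoid_def)
  have plus: "X\<^sup>\<oplus>\<^bsub>R\<^esub> = bplus S ` X" if "X \<in> carrier R" for X
    using sub that by (simp add: restriction_submonoid_def permissible_monoid_def)
  have plus_mult: "X\<^sup>\<oplus>\<^bsub>R\<^esub> \<cdot>\<^bsub>R\<^esub> B = set_product S (bplus S ` X) B" if "X \<in> carrier R" for X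
    using mult[OF R.plus_closed[OF that] B] plus[OF that] by simp
  have perm: "permissible S X" if "X \<in> carrier R" for X
    using sub that by (auto simp: restriction_submonoid_def permissible_monoid_def)
  have sub_S: "X \<subseteq> carrier S" if "X \<in> carrier R" for X
    using perm[OF that] by (simp add: permissible_def order_ideal_def)
  have down: "e \<cdot>\<^bsub>S\<^esub> x \<in> X" if "X \<in> carrier R" "x \<in> X" "e \<in> projections S" for X x e
  proof -
    have "e \<cdot>\<^bsub>S\<^esub> x \<in> carrier S"
      using that sub_S by (blast intro: S.mult_closed S.projection_closed)
    then show ?thesis
      using perm[OF that(1)] that(2) S.projection_mult_le[OF that(3)]
      unfolding permissible_def order_ideal_def by blast
  qed
  show ?thesis
  proof
    assume "A \<preceq>\<^bsub>R\<^esub> B"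
    then obtain X where X: "X \<in> carrier R" "A = X\<^sup>\<oplus>\<^bsub>R\<^esub> \<cdot>\<^bsub>R\<^esub> B"
      unfolding nat_le_def projections_def by blast
    show "A \<subseteq> B"
      unfolding X(2) plus_mult[OF X(1)]
      using down[OF B] sub_S[OF X(1)] by (auto simp: set_product_def)
  next
    assume AB: "A \<subseteq> B"
    have "A = set_product S (bplus S ` A) B"
    proof (intro equalityI subsetI)
      fix x assume x: "x \<in> A"
      then have "x = x\<^sup>\<oplus>\<^bsub>S\<^esub> \<cdot>\<^bsub>S\<^esub> x"
        using sub_S[OF A] S.plus_left by auto
      then show "x \<in> set_product S (bplus S ` A) B"
        using x AB unfolding set_product_def by blast
    next
      fix z assume "z \<in> set_product S (bplus S ` A) B"
      then obtain x y where xy: "z = x\<^sup>\<oplus>\<^bsub>S\<^esub> \<cdot>\<^bsub>S\<^esub> y" "x \<in> A" "y \<in> B"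
        by (auto simp: set_product_def)
      \<comment> \<open>Both x and y lie in B, so compatibility in B swaps them; the result is below
        x, hence in the order ideal A.\<close>
      then have "z = y\<^sup>\<oplus>\<^bsub>S\<^esub> \<cdot>\<^bsub>S\<^esub> x"
        using perm[OF B] AB unfolding permissible_def by blast
      moreover have "y\<^sup>\<oplus>\<^bsub>S\<^esub> \<in> projections S"
        using xy(3) sub_S[OF B] by auto
      ultimately show "z \<in> A"
        using down[OF A xy(2)] by simp
    qed
    then have "A = A\<^sup>\<oplus>\<^bsub>R\<^esub> \<cdot>\<^bsub>R\<^esub> B"
      using plus_mult[OF A] by simp
    then show "A \<preceq>\<^bsub>R\<^esub> B"
      using R.plus_projection[OF A] unfolding nat_le_def by blast
  qed
qed

text \<open>A permissible set contains c exactly when it contains the principal ideal of c, so it is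
  the union of the principal ideals below it. This supplies \<open>determined\<close> for submonoids
  of C(S).\<close>

lemma permissible_submonoid_determined:
  assumes S: "restriction_semigroup S" and sub: "restriction_submonoid R (permissible_monoid S)"
    and ext: "monoid_extension S R (principal_ideal S)"
    and A: "A \<in> carrier R" and B: "B \<in> carrier R"
    and le: "\<And>c. \<lbrakk>c \<in> carrier S; principal_ideal S c \<preceq>\<^bsub>R\<^esub> A\<rbrakk> \<Longrightarrow> principal_ideal S c \<preceq>\<^bsub>R\<^esub> B"
  shows "A \<preceq>\<^bsub>R\<^esub> B"
proof -
  have ideal: "principal_ideal S c \<in> carrier R" if "c \<in> carrier S" for c
    using ext that by (auto simp: monoid_extension_def biunary_embedding_def)
  have A': "order_ideal S A"
    using sub A by (auto simp: restriction_submonoid_def permissible_monoid_def permissible_def)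
  have "A \<subseteq> B"
  proof
    fix c assume c: "c \<in> A"
    then have cS: "c \<in> carrier S" and "principal_ideal S c \<subseteq> A"
      using A' by (auto simp: order_ideal_def principal_ideal_def)
    then have "principal_ideal S c \<subseteq> B"
      using le ideal permissible_submonoid_le_iff[OF S sub] A B by metis
    then show "c \<in> B"
      using cS restriction_semigroup.le_refl[OF S cS] by (auto simp: principal_ideal_def)
  qed
  then show ?thesis
    using permissible_submonoid_le_iff[OF S sub A B] by simp
qed

section \<open>Adjoining an identity\<close>

context restriction_semigroup
begin

lemma adjoin_mult [simp]:
  "Some a \<cdot>\<^bsub>adjoin_identity S\<^esub> Some b = Some (a \<cdot> b)"
  "None \<cdot>\<^bsub>adjoin_identity S\<^esub> y = y"
  "x \<cdot>\<^bsub>adjoin_identity S\<^esub> None = x"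
  by (simp_all add: adjoin_identity_def split: option.split)

lemma adjoin_plus [simp]:
  "(Some a)\<^sup>\<oplus>\<^bsub>adjoin_identity S\<^esub> = Some (a\<^sup>\<oplus>)"
  "None\<^sup>\<oplus>\<^bsub>adjoin_identity S\<^esub> = None"
  by (simp_all add: adjoin_identity_def)

lemma adjoin_star [simp]:
  "(Some a)\<^sup>\<star>\<^bsub>adjoin_identity S\<^esub> = Some (a\<^sup>\<star>)"
  "None\<^sup>\<star>\<^bsub>adjoin_identity S\<^esub> = None"
  by (simp_all add: adjoin_identity_def)

lemma adjoin_carrier_Some [simp]: "Some a \<in> carrier (adjoin_identity S) \<longleftrightarrow> a \<in> carrier S"
  by (auto simp: adjoin_identity_def)

lemma adjoin_carrier_None [simp]:
  "None \<in> carrier (adjoin_identity S) \<longleftrightarrow> \<not> (\<exists>u. is_identity S u)"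
  by (auto simp: adjoin_identity_def)

text \<open>Where an argument is \<open>None\<close>, the identities in two variables collapse to
  facts in one, such as x^+ x = x or (x^+)^+ = x^+.\<close>

lemma restriction_monoid_adjoin: "restriction_monoid (adjoin_identity S)"
proof -
  let ?S1 = "adjoin_identity S"
  have "restriction_semigroup ?S1"
  proof
    show "carrier ?S1 \<noteq> {}"
      using nonempty by (auto simp: adjoin_identity_def)
  next
    fix x y assume xy: "x \<in> carrier ?S1" "y \<in> carrier ?S1"
    show "x \<cdot>\<^bsub>?S1\<^esub> y \<in> carrier ?S1"
      using xy by (cases x; cases y) (simp_all add: mult_closed)
    show "(x\<^sup>\<oplus>\<^bsub>?S1\<^esub> \<cdot>\<^bsub>?S1\<^esub> y)\<^sup>\<oplus>\<^bsub>?S1\<^esub> = x\<^sup>\<oplus>\<^bsub>?S1\<^esub> \<cdot>\<^bsub>?S1\<^esub> y\<^sup>\<oplus>\<^bsub>?S1\<^esub>"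
      using xy by (cases x; cases y) (simp_all add: plus_plus projection_plus)
    show "x\<^sup>\<oplus>\<^bsub>?S1\<^esub> \<cdot>\<^bsub>?S1\<^esub> y\<^sup>\<oplus>\<^bsub>?S1\<^esub> = y\<^sup>\<oplus>\<^bsub>?S1\<^esub> \<cdot>\<^bsub>?S1\<^esub> x\<^sup>\<oplus>\<^bsub>?S1\<^esub>"
      using xy by (cases x; cases y) (simp_all add: plus_comm)
    show "x \<cdot>\<^bsub>?S1\<^esub> y\<^sup>\<oplus>\<^bsub>?S1\<^esub> = (x \<cdot>\<^bsub>?S1\<^esub> y)\<^sup>\<oplus>\<^bsub>?S1\<^esub> \<cdot>\<^bsub>?S1\<^esub> x"
      using xy by (cases x; cases y) (simp_all add: plus_ample[symmetric] plus_left)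
    show "(y \<cdot>\<^bsub>?S1\<^esub> x\<^sup>\<star>\<^bsub>?S1\<^esub>)\<^sup>\<star>\<^bsub>?S1\<^esub> = y\<^sup>\<star>\<^bsub>?S1\<^esub> \<cdot>\<^bsub>?S1\<^esub> x\<^sup>\<star>\<^bsub>?S1\<^esub>"
      using xy by (cases x; cases y) (simp_all add: star_star projection_star)
    show "y\<^sup>\<star>\<^bsub>?S1\<^esub> \<cdot>\<^bsub>?S1\<^esub> x\<^sup>\<star>\<^bsub>?S1\<^esub> = x\<^sup>\<star>\<^bsub>?S1\<^esub> \<cdot>\<^bsub>?S1\<^esub> y\<^sup>\<star>\<^bsub>?S1\<^esub>"
      using xy by (cases x; cases y) (simp_all add: star_comm)
    show "y\<^sup>\<star>\<^bsub>?S1\<^esub> \<cdot>\<^bsub>?S1\<^esub> x = x \<cdot>\<^bsub>?S1\<^esub> (y \<cdot>\<^bsub>?S1\<^esub> x)\<^sup>\<star>\<^bsub>?S1\<^esub>"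
      using xy by (cases x; cases y) (simp_all add: star_ample[symmetric] star_right)
  next
    fix x y z assume "x \<in> carrier ?S1" "y \<in> carrier ?S1" "z \<in> carrier ?S1"
    then show "x \<cdot>\<^bsub>?S1\<^esub> y \<cdot>\<^bsub>?S1\<^esub> z = x \<cdot>\<^bsub>?S1\<^esub> (y \<cdot>\<^bsub>?S1\<^esub> z)"
      by (cases x; cases y; cases z) (simp_all add: assoc)
  next
    fix x assume x: "x \<in> carrier ?S1"
    show "x\<^sup>\<oplus>\<^bsub>?S1\<^esub> \<in> carrier ?S1" "x\<^sup>\<star>\<^bsub>?S1\<^esub> \<in> carrier ?S1"
      "x\<^sup>\<oplus>\<^bsub>?S1\<^esub> \<cdot>\<^bsub>?S1\<^esub> x = x" "x \<cdot>\<^bsub>?S1\<^esub> x\<^sup>\<star>\<^bsub>?S1\<^esub> = x"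
      "(x\<^sup>\<oplus>\<^bsub>?S1\<^esub>)\<^sup>\<star>\<^bsub>?S1\<^esub> = x\<^sup>\<oplus>\<^bsub>?S1\<^esub>" "(x\<^sup>\<star>\<^bsub>?S1\<^esub>)\<^sup>\<oplus>\<^bsub>?S1\<^esub> = x\<^sup>\<star>\<^bsub>?S1\<^esub>"
      using x by (cases x; simp add: plus_closed star_closed plus_left star_right
          star_of_plus plus_of_star)+
  qed
  moreover have "\<exists>u. is_identity ?S1 u"
  proof (cases "\<exists>u. is_identity S u")
    case True
    then obtain u where "is_identity S u" ..
    \<comment> \<open>Here \<open>None\<close> is absent from the carrier, so u keeps its
      role.\<close>
    then have "is_identity ?S1 (Some u)"
      by (auto simp: is_identity_def adjoin_identity_def)
    then show ?thesis ..
  next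
    case False
    then have "is_identity ?S1 None"
      by (simp add: is_identity_def[of ?S1])
    then show ?thesis ..
  qed
  ultimately show ?thesis
    by (simp add: restriction_monoid_def)
qed

text \<open>A witness in the larger monoid can be normalised to a^+, which comes from
  \<open>S\<close>; hence the adjoined projection creates no new comparisons.\<close>

lemma adjoin_le_Some:
  assumes "a \<in> carrier S" "b \<in> carrier S"
  shows "Some a \<preceq>\<^bsub>adjoin_identity S\<^esub> Some b \<longleftrightarrow> a \<preceq> b"
proof -
  interpret S1: restriction_semigroup "adjoin_identity S"
    using restriction_monoid_adjoin by (simp add: restriction_monoid_def)
  have "Some a \<preceq>\<^bsub>adjoin_identity S\<^esub> Some b \<longleftrightarrow> a = a\<^sup>\<oplus> \<cdot> b"
    using S1.le_eq_plus[of "Some a" "Some b"] S1.projection_mult_le[of "Some (a\<^sup>\<oplus>)" "Some b"]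
      S1.plus_projection[of "Some a"] assms by auto
  then show ?thesis
    using assms le_eq_plus projection_mult_le plus_projection by metis
qed

text \<open>Multiplying a projection of \<open>S\<close> by 1 stays in \<open>S\<close>. Below the
  projection 1 lies every projection of \<open>S\<close>, and one exists as \<open>S\<close> is
  nonempty.\<close>

lemma monoid_extension_adjoin: "monoid_extension S (adjoin_identity S) Some"
proof -
  let ?S1 = "adjoin_identity S"
  interpret S1: restriction_semigroup ?S1
    using restriction_monoid_adjoin by (simp add: restriction_monoid_def)
  have below_None: "Some e \<preceq>\<^bsub>?S1\<^esub> None" if "e \<in> projections S" for e
    using that S1.plus_projection[of "Some e"] S1.projection_mult_le[of "Some e" None]
    by (simp add: projection_closed projection_plus)
  have ex: "\<exists>e\<in>projections S. Some e \<preceq>\<^bsub>?S1\<^esub> p" if "p \<in> projections ?S1" for p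
  proof (cases p)
    case None
    then show ?thesis
      using below_None nonempty plus_projection by blast
  next
    case (Some e)
    then have "e \<in> carrier S" "Some (e\<^sup>\<oplus>) = Some e"
      using S1.projection_closed[OF that] S1.projection_plus[OF that] by auto
    then have "e \<in> projections S"
      by (metis option.inject plus_projection)
    then show ?thesis
      using Some S1.le_refl[of p] that S1.projection_closed by blast
  qed
  have "Some e \<cdot>\<^bsub>?S1\<^esub> r \<in> Some ` carrier S" "r \<cdot>\<^bsub>?S1\<^esub> Some e \<in> Some ` carrier S"
    if "e \<in> projections S" "r \<in> carrier ?S1" for e r
    using that by (cases r; auto simp: projection_closed mult_closed)+
  then show ?thesis
    unfolding monoid_extension_def biunary_embedding_def
    using restriction_monoid_adjoin ex S1.plus_projection S1.star_projection by auto
qed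

text \<open>
  The only interesting case is \<open>r = 1\<close>, \<open>s = p \<in> S\<close>: then \<open>p\<close> is above all projections of
  \<open>S\<close>; being above \<open>p\<^sup>+\<close> it is itself a projection, hence an identity of \<open>S\<close>.
\<close>

lemma adjoin_determined:
  assumes r: "r \<in> carrier (adjoin_identity S)" and s: "s \<in> carrier (adjoin_identity S)"
    and le: "\<And>c. \<lbrakk>c \<in> carrier S; Some c \<preceq>\<^bsub>adjoin_identity S\<^esub> r\<rbrakk> \<Longrightarrow> Some c \<preceq>\<^bsub>adjoin_identity S\<^esub> s"
  shows "r \<preceq>\<^bsub>adjoin_identity S\<^esub> s"
proof -
  let ?S1 = "adjoin_identity S"
  interpret S1: restriction_semigroup ?S1
    using restriction_monoid_adjoin by (simp add: restriction_monoid_def)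
  show ?thesis
  proof (cases r)
    case (Some c)
    then show ?thesis
      using le[of c] r S1.le_refl by simp
  next
    case r_None: None
    show ?thesis
    proof (cases s)
      case None
      then show ?thesis
        using r_None r S1.le_refl by simp
    next
      case (Some p)
      then have p: "p \<in> carrier S"
        using s by simp
      have below: "e \<preceq> p" if "e \<in> projections S" for e
      proof -
        have "Some e \<in> projections ?S1"
          using that S1.plus_projection[of "Some e"] by (simp add: projection_closed projection_plus)
        then have "Some e \<preceq>\<^bsub>?S1\<^esub> None"
          using S1.projection_mult_le[of "Some e" None] by simp
        then have "Some e \<preceq>\<^bsub>?S1\<^esub> Some p"
          using le[of e] r_None Some that by (simp add: projection_closed)
        then show ?thesis
          using that p by (simp add: adjoin_le_Some projection_closed)
      qed
      have "p = p\<^sup>\<oplus>"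
        using le_eq_plus[OF below[of "p\<^sup>\<oplus>"] p] p by (simp add: projection_plus plus_left)
      then have p_proj: "p \<in> projections S"
        using p by (metis plus_projection)
      have absorb: "e \<cdot> p = e" if "e \<in> projections S" for e
        using le_eq_plus[OF below[OF that] p] that by (simp add: projection_plus)
      have "is_identity S p"
        unfolding is_identity_def
      proof (intro conjI ballI)
        fix x assume x: "x \<in> carrier S"
        \<comment> \<open>Since p absorbs into x^+ and x^*, inserting x = x^+ x or x = x x^* shows
          that p fixes x on either side.\<close>
        have "p \<cdot> x\<^sup>\<oplus> = x\<^sup>\<oplus>" "x\<^sup>\<star> \<cdot> p = x\<^sup>\<star>"
          using absorb x p_proj projection_comm plus_projection star_projection by metis+
        then show "p \<cdot> x = x" "x \<cdot> p = x"
          using x p by (metis assoc plus_closed plus_left, metis assoc star_closed star_right)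
      qed (rule p)
      \<comment> \<open>\<open>None\<close> belongs to the carrier only when \<open>S\<close> has no
        identity, so this case is contradictory.\<close>
      then show ?thesis
        using r r_None by auto
    qed
  qed
qed

end

section \<open>The monoid case\<close>

text \<open>If \<open>S\<close> has an identity, nothing is adjoined and \<open>R\<close> can be
  \<open>S\<close> itself; each projection r^+ or r^* is then its own lower bound.\<close>

lemma monoid_extension_id:
  assumes "restriction_monoid S"
  shows "monoid_extension S S id"
proof -
  interpret S: restriction_semigroup S
    using assms by (simp add: restriction_monoid_def)
  have "\<exists>e\<in>projections S. e \<preceq>\<^bsub>S\<^esub> p" if "p \<in> projections S" for p
    using that S.le_refl S.projection_closed by blast
  then show ?thesis
    unfolding monoid_extension_def biunary_embedding_def
    using assms by (simp add: S.projection_closed S.mult_closed)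
qed

locale monoid_subhom = subhom_extension S T S id \<alpha>
  for S :: "'a biunary" and T :: "('t, 'm) monoid_scheme" and \<alpha> :: "'t \<Rightarrow> 'a"
begin

lemma greatest_closed: "t \<in> carrier T \<Longrightarrow> (\<alpha> t, t) \<in> carrier M"
  using alpha_closed S.le_refl by simp

lemma is_identity_M: "is_identity M (\<alpha> \<one>\<^bsub>T\<^esub>, \<one>\<^bsub>T\<^esub>)"
  using alpha_one greatest_closed[OF T.one_closed]
  by (auto simp: is_identity_def)

lemma restriction_monoid_M: "restriction_monoid M"
  using restriction_semigroup_M is_identity_M by (auto simp: restriction_monoid_def)

lemma identity_M: "identity M = (\<alpha> \<one>\<^bsub>T\<^esub>, \<one>\<^bsub>T\<^esub>)"
  using restriction_semigroup.identity_eqI[OF restriction_semigroup_M is_identity_M] .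

text \<open>Rewriting a as a^+ (t\<alpha>) serves twice: it puts (a, t) below (t\<alpha>, t), and it
  yields the decomposition of \<open>M\<close> required for T-properness.\<close>

lemma M_eq_projection_mult:
  assumes "(a, t) \<in> carrier M"
  shows "(a, t) = (a\<^sup>\<oplus>\<^bsub>S\<^esub>, \<one>\<^bsub>T\<^esub>) \<cdot>\<^bsub>M\<^esub> (\<alpha> t, t)" "(a\<^sup>\<oplus>\<^bsub>S\<^esub>, \<one>\<^bsub>T\<^esub>) \<in> projections M"
  using assms S.le_eq_plus[of a "\<alpha> t"] alpha_closed[of t]
  by (auto simp: projections_M)

lemma F_restriction_M: "F_restriction_monoid M"
  unfolding F_restriction_monoid_def
proof (intro conjI ballI)
  fix C assume "C \<in> carrier M // rel_sigma M"
  then obtain a t where at: "(a, t) \<in> carrier M" "C = rel_sigma M `` {(a, t)}"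
    by (auto elim!: quotientE simp del: M_carrier)
  then have t: "t \<in> carrier T"
    by simp
  have "(\<alpha> t, t) \<in> C"
    using at greatest_closed[OF t] by (simp add: sigma_M del: M_carrier)
  moreover have "x \<preceq>\<^bsub>M\<^esub> (\<alpha> t, t)" if x: "x \<in> C" for x
  proof -
    obtain b where "x = (b, t)" "(b, t) \<in> carrier M"
      using x at by (cases x) (auto simp: sigma_M simp del: M_carrier)
    then show ?thesis
      using M_eq_projection_mult unfolding nat_le_def by metis
  qed
  ultimately show "\<exists>m\<in>C. \<forall>a\<in>C. a \<preceq>\<^bsub>M\<^esub> m"
    by blast
qed (rule restriction_monoid_M proper_M)+

section \<open>T-properness\<close>

lemma hom_imp_T_proper:
  assumes "\<alpha> \<in> hom T (plain_reduct S)"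
  shows "T_proper T M"
proof -
  \<comment> \<open>The candidate consists of the greatest elements of the \<sigma>-classes; it is
    closed under products because \<alpha> is multiplicative.\<close>
  let ?T' = "(\<lambda>t. (\<alpha> t, t)) ` carrier T"
  have hom: "\<alpha> (t \<otimes>\<^bsub>T\<^esub> u) = \<alpha> t \<cdot>\<^bsub>S\<^esub> \<alpha> u" if "t \<in> carrier T" "u \<in> carrier T" for t u
    using assms that hom_iff by blast
  have "submonoid ?T' (plain_reduct M)"
    by unfold_locales
      (auto simp: plain_reduct_def identity_M hom[symmetric] greatest_closed simp del: M_carrier)
  moreover have "(\<lambda>t. (\<alpha> t, t)) \<in> iso T ((plain_reduct M)\<lparr>carrier := ?T'\<rparr>)"
    by (auto simp: iso_def hom_def bij_betw_def inj_on_def plain_reduct_def hom)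
  moreover have "carrier M = set_product M (projections M) ?T'"
  proof (intro equalityI subsetI)
    fix x assume x: "x \<in> carrier M"
    obtain a t where at: "x = (a, t)"
      by fastforce
    then have "t \<in> carrier T"
      using x by simp
    then show "x \<in> set_product M (projections M) ?T'"
      using M_eq_projection_mult[of a t] x at unfolding set_product_def by blast
  next
    fix x assume "x \<in> set_product M (projections M) ?T'"
    then show "x \<in> carrier M"
      using restriction_semigroup.mult_closed[OF restriction_semigroup_M]
        restriction_semigroup.projection_closed[OF restriction_semigroup_M] greatest_closed
      by (auto simp: set_product_def simp del: M_carrier M_mult)
  qed
  moreover have "\<forall>x\<in>?T'. \<forall>y\<in>?T'. (x, y) \<in> rel_sigma M \<longrightarrow> x = y"
    by (auto simp: sigma_M)
  ultimately show ?thesis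
    unfolding T_proper_def is_iso_def using restriction_monoid_M by blast
qed

lemma T_proper_imp_hom:
  assumes "T_proper T M"
  shows "\<alpha> \<in> hom T (plain_reduct S)"
proof -
  obtain T' where sub: "submonoid T' (plain_reduct M)"
    and prod: "carrier M = set_product M (projections M) T'"
    and sep: "\<And>x y. \<lbrakk>x \<in> T'; y \<in> T'; (x, y) \<in> rel_sigma M\<rbrakk> \<Longrightarrow> x = y"
    using assms unfolding T_proper_def by blast
  have T'_closed: "T' \<subseteq> carrier M" and T'_mult: "\<And>x y. \<lbrakk>x \<in> T'; y \<in> T'\<rbrakk> \<Longrightarrow> x \<cdot>\<^bsub>M\<^esub> y \<in> T'"
    using sub by (auto simp: submonoid_def plain_reduct_def)
  \<comment> \<open>Write (t\<alpha>, t) = px with x in T'. Then x = (b, t) with t\<alpha> \<le> b,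
    while b \<le> t\<alpha> because x lies in \<open>M\<close>; so x is (t\<alpha>, t).\<close>
  have greatest: "(\<alpha> t, t) \<in> T'" if t: "t \<in> carrier T" for t
  proof -
    obtain p x where px: "p \<in> projections M" "x \<in> T'" "(\<alpha> t, t) = p \<cdot>\<^bsub>M\<^esub> x"
      using greatest_closed[OF t] prod unfolding set_product_def by blast
    obtain e where e: "e \<in> projections S" "p = (e, \<one>\<^bsub>T\<^esub>)"
      using px(1) by (auto simp: projections_M)
    obtain b u where b: "x = (b, u)" "(b, u) \<in> carrier M"
      using px(2) T'_closed by (cases x) blast
    then have "u = t" "\<alpha> t = e \<cdot>\<^bsub>S\<^esub> b"
      using px(3) e by auto
    then have "\<alpha> t \<preceq>\<^bsub>S\<^esub> b" "b \<preceq>\<^bsub>S\<^esub> \<alpha> t"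
      using e b by (auto simp: S.projection_mult_le)
    then have "b = \<alpha> t"
      using S.le_antisym b alpha_closed[OF t] by auto
    then show ?thesis
      using px(2) b \<open>u = t\<close> by simp
  qed
  have "\<alpha> (t \<otimes>\<^bsub>T\<^esub> u) = \<alpha> t \<cdot>\<^bsub>S\<^esub> \<alpha> u" if t: "t \<in> carrier T" and u: "u \<in> carrier T" for t u
  proof -
    \<comment> \<open>Both elements of T' have second coordinate tu, so separation by \<sigma>
      forces them to be equal.\<close>
    have "(\<alpha> t, t) \<cdot>\<^bsub>M\<^esub> (\<alpha> u, u) \<in> T'" "(\<alpha> (t \<otimes>\<^bsub>T\<^esub> u), t \<otimes>\<^bsub>T\<^esub> u) \<in> T'"
      using t u greatest T'_mult by (blast, simp)
    moreover from this have
      "((\<alpha> t, t) \<cdot>\<^bsub>M\<^esub> (\<alpha> u, u), (\<alpha> (t \<otimes>\<^bsub>T\<^esub> u), t \<otimes>\<^bsub>T\<^esub> u)) \<in> rel_sigma M"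
      using T'_closed by (auto simp: sigma_M simp del: M_carrier)
    ultimately show ?thesis
      using sep by force
  qed
  then show ?thesis
    by (simp add: hom_iff)
qed

lemma perfect_F_restriction_iff_hom:
  "perfect_F_restriction_monoid M \<longleftrightarrow> \<alpha> \<in> hom T (plain_reduct S)"
proof -
  have "perfect_F_restriction_monoid M \<longleftrightarrow> almost_perfect M"
    using F_restriction_M proper_M
    by (simp add: perfect_F_restriction_monoid_def almost_perfect_def)
  also have "\<dots> \<longleftrightarrow> \<alpha> \<in> hom T (plain_reduct S)"
    \<comment> \<open>With \<iota> = \<open>id\<close> the condition \<open>determined\<close> is
      immediate: take c = r.\<close>
    by (rule almost_perfect_iff_hom) (simp add: S.le_refl)
  finally show ?thesis .
qed

end

section \<open>Assembly of the statements\<close>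

theorem theorem9p1:
  fixes S :: "'a biunary" and T :: "('t, 'm) monoid_scheme"
  assumes "restriction_semigroup S" and "monoid T"
  shows
    "(\<forall>(R :: 'b biunary) \<iota> \<alpha>.
        monoid_extension S R \<iota> \<and> monoidal_subhom T R \<alpha> \<longrightarrow>
        proper (S_TR S R \<iota> T \<alpha>))
   \<and> (\<forall>(R :: 'a set biunary) \<alpha>.
        monoid_extension S R (principal_ideal S) \<and>
        restriction_submonoid R (permissible_monoid S) \<and> monoidal_subhom T R \<alpha> \<longrightarrow>
        (almost_perfect (S_TR S R (principal_ideal S) T \<alpha>) \<longleftrightarrow> \<alpha> \<in> hom T (plain_reduct R)))
   \<and> (\<forall>\<alpha>. monoidal_subhom T (adjoin_identity S) \<alpha> \<longrightarrow>
        (almost_perfect (S_TR S (adjoin_identity S) Some T \<alpha>) \<longleftrightarrow>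
           \<alpha> \<in> hom T (plain_reduct (adjoin_identity S))))
   \<and> (restriction_monoid S \<longrightarrow>
        (\<forall>\<alpha>. monoidal_subhom T S \<alpha> \<longrightarrow>
          F_restriction_monoid (S_TR S S id T \<alpha>) \<and>
          (T_proper T (S_TR S S id T \<alpha>) \<longleftrightarrow> perfect_F_restriction_monoid (S_TR S S id T \<alpha>)) \<and>
          (T_proper T (S_TR S S id T \<alpha>) \<longleftrightarrow> \<alpha> \<in> hom T (plain_reduct S))))"
proof (intro conjI allI impI, goal_cases)
  case (1 R \<iota> \<alpha>)
  then interpret subhom_extension S T R \<iota> \<alpha>
    using assms by (simp add: subhom_extension_def subhom_extension_axioms_def)
  show ?case
    by (rule proper_M)
next
  case (2 R \<alpha>)
  then interpret subhom_extension S T R "principal_ideal S" \<alpha>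
    using assms by (simp add: subhom_extension_def subhom_extension_axioms_def)
  show ?case
    using almost_perfect_iff_hom permissible_submonoid_determined assms(1) 2 by metis
next
  case (3 \<alpha>)
  then interpret subhom_extension S T "adjoin_identity S" Some \<alpha>
    using assms restriction_semigroup.monoid_extension_adjoin
    by (simp add: subhom_extension_def subhom_extension_axioms_def)
  show ?case
    by (rule almost_perfect_iff_hom) (rule S.adjoin_determined)
next
  case (4 \<alpha>)
  then interpret monoid_subhom S T \<alpha>
    using assms monoid_extension_id
    by (simp add: monoid_subhom_def subhom_extension_def subhom_extension_axioms_def)
  show ?case
    by (rule F_restriction_M)
next
  case (5 \<alpha>)
  then interpret monoid_subhom S T \<alpha>
    using assms monoid_extension_id
    by (simp add: monoid_subhom_def subhom_extension_def subhom_extension_axioms_def)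
  show ?case
    \<comment> \<open>T-properness and perfection are linked through the homomorphism property, to
      which each is equivalent.\<close>
    using T_proper_imp_hom hom_imp_T_proper perfect_F_restriction_iff_hom by blast
next
  case (6 \<alpha>)
  then interpret monoid_subhom S T \<alpha>
    using assms monoid_extension_id
    by (simp add: monoid_subhom_def subhom_extension_def subhom_extension_axioms_def)
  show ?case
    using T_proper_imp_hom hom_imp_T_proper by blast
qed

end
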